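(* For all sufficiently large $n$, $$\max_{v(G)=n}\bigl(\mu_1(G)-\mu_n(G)\bigr)=\max_{v(G)=n}\|G\|_{F_2},$$ where both maxima are taken over all graphs $G$ of order $n$.
   Context: Graphs are finite, simple and undirected; $v(G)$ is the number of vertices (the order) of $G$. For a graph $G$ of order $n$ with adjacency matrix $A$, $\mu_1(G)\geq\cdots\geq\mu_n(G)$ are the eigenvalues of $A$, and $\|G\|_{F_2}=\sigma_1(A)+\sigma_2(A)$ is the sum of the two largest singular values of $A$ (with multiplicity), i.e. the sum of the two largest absolute values of eigenvalues of $A$. *)

theory Defs
  imports
    "Graph_Theory.Pair_Digraph"
    "Jordan_Normal_Form.Char_Poly"
    "HOL-Library.Multiset"
    Complex_Main
begin

text \<open>
  A finite simple undirected graph is a \<^const>\<open>pair_graph\<close>: a finite loopless digraph without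
  multiple arcs whose arc set is symmetric, an edge $uv$ being the two arcs $(u,v)$ and $(v,u)$.
  Every graph of order \<open>n\<close> is isomorphic to one with vertex set \<open>{0..<n}\<close>, and isomorphic graphs
  have the same spectrum.
\<close>

definition graphs_of_order :: "nat \<Rightarrow> nat pair_pre_digraph set" where
  "graphs_of_order n = {G. pair_graph G \<and> pverts G = {0..<n}}"

definition adjacency_matrix :: "nat pair_pre_digraph \<Rightarrow> real mat" where
  "adjacency_matrix G =
     mat (card (pverts G)) (card (pverts G)) (\<lambda>(i, j). if (i, j) \<in> parcs G then 1 else 0)"

text \<open>
  The real roots of the characteristic polynomial in nonincreasing order, with multiplicity;
  below it is only applied to real symmetric matrices, where all roots are real.
  The index \<open>k\<close> ranges over \<open>{1..dim_row A}\<close>.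
\<close>

definition eigval :: "real mat \<Rightarrow> nat \<Rightarrow> real" where
  "eigval A k = rev (sorted_list_of_multiset (proots (char_poly A))) ! (k - 1)"

definition singval :: "real mat \<Rightarrow> nat \<Rightarrow> real" where
  "singval A k = sqrt (eigval (transpose_mat A * A) k)"

definition graph_eigval :: "nat pair_pre_digraph \<Rightarrow> nat \<Rightarrow> real" where
  "graph_eigval G k = eigval (adjacency_matrix G) k"

definition F2_norm :: "nat pair_pre_digraph \<Rightarrow> real" where
  "F2_norm G = singval (adjacency_matrix G) 1 + singval (adjacency_matrix G) 2"

text \<open>The maxima over \<^const>\<open>graphs_of_order\<close> are taken over a finite nonempty set.\<close>

lemma finite_graphs_of_order: "finite (graphs_of_order n)"
proof (rule finite_subset)
  show "graphs_of_order n \<subseteq>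
    (\<lambda>E. \<lparr>pverts = {0..<n}, parcs = E\<rparr>) ` Pow ({0..<n} \<times> {0..<n})"
  proof
    fix G assume "G \<in> graphs_of_order n"
    then have G: "pair_graph G" "pverts G = {0..<n}"
      by (auto simp: graphs_of_order_def)
    interpret pair_graph G by (fact G(1))
    have "parcs G \<subseteq> {0..<n} \<times> {0..<n}"
      using G(2) in_arcsD1 in_arcsD2 by fastforce
    moreover have "G = \<lparr>pverts = {0..<n}, parcs = parcs G\<rparr>"
      using G(2) by simp
    ultimately show "G \<in> (\<lambda>E. \<lparr>pverts = {0..<n}, parcs = E\<rparr>) ` Pow ({0..<n} \<times> {0..<n})"
      by blast
  qed
qed simp

lemma graphs_of_order_nonempty: "graphs_of_order n \<noteq> {}"
proof -
  have "pair_graph \<lparr>pverts = {0..<n}, parcs = {}\<rparr>"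
    by unfold_locales (auto simp: symmetric_def sym_def)
  then have "\<lparr>pverts = {0..<n}, parcs = {}\<rparr> \<in> graphs_of_order n"
    by (simp add: graphs_of_order_def)
  then show ?thesis by blast
qed

end

(* A sum of two largest singular values is |d i| + |d j| for two eigenvalues d i, d j. If the signs
   differ it is at most the spread, and by Perron-Frobenius the same holds if both are negative. If
   both are nonnegative it is at most mu_1 + mu_2, which never exceeds 23/20 n, whereas the complete
   split graph with clique size about 2n/3 has spread about 2n/sqrt 3 > 23/20 n.

   For mu_1 + mu_2 <= 23/20 n, replace the adjacency matrix by a 0/1 matrix M whose complement
   N = J - M is bipartite and for which lam + mu = u^T M u + w^T M w is at least mu_1 + mu_2, with
   u, w orthonormal and w orthogonal to the all-ones vector. Then 2 mu^2 <= ||N||^2 because N is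
   bipartite. The part of M inside the two classes has rank two and trace n, while its part between
   the classes has symmetric spectrum, so the two smallest eigenvalues of M sum to at most
   n - (lam + mu). Hence n^2 = ||M||^2 + ||N||^2 >= lam^2 + 3 mu^2 + (lam + mu - n)^2 / 2 whenever
   lam + mu >= n. *)

theory Submission
  imports Defs "HOL-Computational_Algebra.Fundamental_Theorem_Algebra"
    "HOL-Combinatorics.List_Permutation"
begin

section \<open>Diagonalization of real symmetric matrices\<close>

text \<open>Some complex root \<open>z\<close> of the characteristic polynomial exists. For its
  eigenvector \<open>w\<close> the Hermitian form \<open>S\<close> is real by symmetry of
  \<open>A\<close> and equals \<open>z\<close> times the positive squared norm \<open>r\<close>, so
  \<open>z\<close> is real.\<close>

lemma real_symmetric_eigenvalue_exists:
  fixes A :: "real mat"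
  assumes A: "A \<in> carrier_mat n n" and sym: "transpose_mat A = A" and n: "0 < n"
  shows "\<exists>e. eigenvalue A e"
proof -
  define C where "C = map_mat complex_of_real A"
  have C: "C \<in> carrier_mat n n" using A by (simp add: C_def)
  have "degree (char_poly C) = n" using degree_monic_char_poly[OF C] by simp
  then have "\<not> constant (poly (char_poly C))" using n by (simp add: constant_degree)
  then obtain z where z: "poly (char_poly C) z = 0"
    using fundamental_theorem_of_algebra by blast
  then obtain w where w: "w \<in> carrier_vec n" "w \<noteq> 0\<^sub>v n" "C *\<^sub>v w = z \<cdot>\<^sub>v w"
    using C unfolding eigenvalue_root_char_poly[OF C, symmetric] eigenvalue_def eigenvector_def by auto
  define S where "S = (\<Sum>i<n. \<Sum>j<n. complex_of_real (A $$ (i, j)) * w $ j * cnj (w $ i))"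
  define r where "r = (\<Sum>i<n. (cmod (w $ i))\<^sup>2)"
  have symij: "A $$ (j, i) = A $$ (i, j)" if "i < n" "j < n" for i j
    using that A arg_cong[OF sym, of "\<lambda>M. M $$ (i, j)"] by simp
  have "cnj S = (\<Sum>i<n. \<Sum>j<n. complex_of_real (A $$ (i, j)) * cnj (w $ j) * w $ i)"
    by (simp add: S_def)
  also have "\<dots> = (\<Sum>j<n. \<Sum>i<n. complex_of_real (A $$ (i, j)) * cnj (w $ j) * w $ i)"
    by (rule sum.swap)
  also have "\<dots> = S" unfolding S_def by (intro sum.cong refl) (simp add: symij mult_ac)
  finally have real_S: "cnj S = S" .
  have "(\<Sum>j<n. complex_of_real (A $$ (i, j)) * w $ j) = z * w $ i" if "i < n" for i
    using arg_cong[OF w(3), of "\<lambda>v. v $ i"] that w(1) A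
    by (simp add: C_def scalar_prod_def atLeast0LessThan)
  then have "S = (\<Sum>i<n. z * w $ i * cnj (w $ i))"
    by (simp add: S_def sum_distrib_right[symmetric])
  also have "\<dots> = z * r"
    by (simp add: r_def sum_distrib_left mult.assoc complex_norm_square[symmetric])
  finally have S: "S = z * r" .
  obtain i where "i < n" "w $ i \<noteq> 0"
    using w(1,2) by (metis carrier_vecD eq_vecI index_zero_vec)
  then have "0 < (cmod (w $ i))\<^sup>2" "(cmod (w $ i))\<^sup>2 \<le> r"
    by (auto simp: r_def intro: member_le_sum)
  then have "r \<noteq> 0" by linarith
  then have "cnj z = z" using real_S S by simp
  then obtain e where e: "z = complex_of_real e"
    by (metis Reals_cnj_iff Reals_cases)
  have "complex_of_real (poly (char_poly A) e) = poly (char_poly C) z"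
    unfolding C_def e of_real_hom.char_poly_hom[OF A] by simp
  then have "poly (char_poly A) e = 0" using z by simp
  then show ?thesis using eigenvalue_root_char_poly[OF A] by blast
qed

text \<open>\<open>W\<close> is the reflection along \<open>u\<close>, the difference of
  \<open>v\<close> and the first unit vector; it swaps these two vectors and is its own
  inverse.\<close>

lemma householder_reflection:
  fixes v :: "real vec"
  assumes v: "v \<in> carrier_vec n" "v \<bullet> v = 1" and n: "0 < n"
  obtains W where "W \<in> carrier_mat n n" "transpose_mat W = W" "W * W = 1\<^sub>m n" "W *\<^sub>v unit_vec n 0 = v"
proof -
  define u where "u i = v $ i - (if i = 0 then 1 else 0)" for i
  define q where "q = (\<Sum>i<n. u i * u i)"
  define c where "c = 2 / q"
  define W where "W = mat n n (\<lambda>(i, j). (if i = j then 1 else 0) - c * u i * u j)"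
  have W: "W \<in> carrier_mat n n" by (simp add: W_def)
  \<comment> \<open>If \<open>v\<close> is the first unit vector, then \<open>q = 0\<close> and
    \<open>c = 2 / 0 = 0\<close>, so that \<open>W\<close> is the identity. The factor
    \<open>c * u i\<close> makes the equation hold in this case too.\<close>
  have cq: "c * u i * (c * q) = c * u i * 2" for i by (simp add: c_def)
  have "W * W = 1\<^sub>m n"
  proof (rule eq_matI)
    fix i j assume "i < dim_row (1\<^sub>m n :: real mat)" "j < dim_col (1\<^sub>m n :: real mat)"
    then have ij: "i < n" "j < n" by auto
    have "(W * W) $$ (i, j) = (\<Sum>k<n. ((if i = k then 1 else 0) - c * u i * u k) * ((if k = j then 1 else 0) - c * u k * u j))"
      using ij by (simp add: W_def scalar_prod_def atLeast0LessThan)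
    also have "\<dots> = (\<Sum>k<n. (if k = i then (if k = j then 1 else 0) - c * u k * u j else 0)
      + (if k = j then - (c * u i * u k) else 0) + c * u i * c * u j * (u k * u k))"
      by (intro sum.cong refl) (simp add: algebra_simps)
    also have "\<dots> = (if i = j then 1 else 0) - c * u i * u j - c * u i * u j + c * u i * c * u j * q"
      using ij by (simp add: sum.distrib q_def sum_distrib_left)
    also have "\<dots> = (if i = j then 1 else 0)"
      using arg_cong[OF cq[of i], of "\<lambda>x. x * u j"] by (simp add: algebra_simps)
    finally show "(W * W) $$ (i, j) = 1\<^sub>m n $$ (i, j)" using ij by simp
  qed (use W in auto)
  moreover have "W *\<^sub>v unit_vec n 0 = v"
  proof (rule eq_vecI)
    fix i assume "i < dim_vec v"
    then have i: "i < n" using v by simp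
    have vv: "(\<Sum>i<n. v $ i * v $ i) = 1" using v by (simp add: scalar_prod_def atLeast0LessThan)
    have "q = (\<Sum>i<n. v $ i * v $ i + (if i = 0 then 1 - 2 * v $ i else 0))"
      unfolding q_def u_def by (intro sum.cong) (auto simp: algebra_simps)
    also have "\<dots> = - 2 * u 0" using n vv by (simp add: sum.distrib u_def)
    finally have q: "q = - 2 * u 0" .
    have u0: "u i = 0" if "q = 0"
      using that i by (simp add: q_def sum_nonneg_eq_0_iff)
    have "(W *\<^sub>v unit_vec n 0) $ i = (if i = 0 then 1 else 0) - c * u i * u 0"
      using i n by (simp add: W_def)
    also have "\<dots> = v $ i"
    proof (cases "q = 0")
      case True
      then show ?thesis using u0 by (simp add: u_def)
    next
      case False
      then have "c * u 0 = - 1" using q by (simp add: c_def)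
      then have "c * u i * u 0 = - u i" by (metis mult.commute mult.left_commute mult_minus1)
      then show ?thesis by (simp add: u_def)
    qed
    finally show "(W *\<^sub>v unit_vec n 0) $ i = v $ i" .
  qed (use W v in auto)
  moreover have "transpose_mat W = W" by (rule eq_matI) (auto simp: W_def)
  ultimately show ?thesis using that W by blast
qed

text \<open>Induction on the size: conjugating by a reflection that sends the first unit vector to a
  unit eigenvector clears the first row and column except for the eigenvalue, and leaves a smaller
  symmetric block.\<close>

theorem real_symmetric_diagonalization:
  fixes A :: "real mat"
  assumes "A \<in> carrier_mat n n" "transpose_mat A = A"
  shows "\<exists>U D. U \<in> carrier_mat n n \<and> D \<in> carrier_mat n n \<and> diagonal_mat D
    \<and> U * transpose_mat U = 1\<^sub>m n \<and> A = U * D * transpose_mat U"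
  using assms
proof (induction n arbitrary: A)
  case 0
  then show ?case
    by (intro exI[of _ "1\<^sub>m 0"] exI[of _ A]) (auto simp: diagonal_mat_def)
next
  case (Suc m)
  let ?n = "Suc m"
  note A = Suc.prems(1)
  obtain e v0 where v0: "v0 \<in> carrier_vec ?n" "v0 \<noteq> 0\<^sub>v ?n" "A *\<^sub>v v0 = e \<cdot>\<^sub>v v0"
    using real_symmetric_eigenvalue_exists[OF Suc.prems] A
    unfolding eigenvalue_def eigenvector_def by auto
  define v where "v = (1 / sqrt (v0 \<bullet> v0)) \<cdot>\<^sub>v v0"
  have "0 < v0 \<bullet> v0" using conjugate_square_greater_0_vec[OF v0(1)] v0(2)
    by (simp add: conjugate_vec_def)
  then have v: "v \<in> carrier_vec ?n" "v \<bullet> v = 1" "A *\<^sub>v v = e \<cdot>\<^sub>v v"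
    using v0 A by (auto simp: v_def mult_mat_vec smult_smult_assoc mult.commute)
  obtain W where W: "W \<in> carrier_mat ?n ?n" and WT: "transpose_mat W = W"
    and WW: "W * W = 1\<^sub>m ?n" and We: "W *\<^sub>v unit_vec ?n 0 = v"
    using householder_reflection[OF v(1,2)] by blast
  define B where "B = W * A * W"
  have B: "B \<in> carrier_mat ?n ?n" using W A by (simp add: B_def)
  have BT: "transpose_mat B = B"
    using W A Suc.prems(2) WT by (simp add: B_def transpose_mult[of _ ?n ?n _ ?n] assoc_mult_mat[of _ ?n ?n _ ?n _ ?n])
  have "W *\<^sub>v v = unit_vec ?n 0"
    using W WW by (simp add: We[symmetric] assoc_mult_mat_vec[symmetric, of _ ?n ?n _ ?n])
  then have "B *\<^sub>v unit_vec ?n 0 = e \<cdot>\<^sub>v unit_vec ?n 0"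
    using W A v We by (simp add: B_def assoc_mult_mat_vec[of _ ?n ?n _ ?n] mult_mat_vec[of _ ?n ?n])
  then have B0: "B $$ (i, 0) = (if i = 0 then e else 0)" if "i < ?n" for i
  proof -
    have "B $$ (i, 0) = (B *\<^sub>v unit_vec ?n 0) $ i" using that B by simp
    also have "\<dots> = (e \<cdot>\<^sub>v unit_vec ?n 0) $ i"
      by (simp only: \<open>B *\<^sub>v unit_vec ?n 0 = e \<cdot>\<^sub>v unit_vec ?n 0\<close>)
    finally show ?thesis using that by simp
  qed
  then have B0': "B $$ (0, i) = (if i = 0 then e else 0)" if "i < ?n" for i
    using that B arg_cong[OF BT, of "\<lambda>M. M $$ (i, 0)"] by auto
  define B3 where "B3 = mat m m (\<lambda>(i, j). B $$ (Suc i, Suc j))"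
  define E where "E = mat 1 1 (\<lambda>_. e)"
  have E: "E \<in> carrier_mat 1 1" by (simp add: E_def)
  have B3: "B3 \<in> carrier_mat m m" by (simp add: B3_def)
  have B_block: "B = four_block_mat E (0\<^sub>m 1 m) (0\<^sub>m m 1) B3"
    using B B0 B0' by (intro eq_matI) (auto simp: E_def B3_def)
  have "transpose_mat B3 = B3"
  proof (rule eq_matI)
    fix i j assume "i < dim_row B3" "j < dim_col B3"
    then show "transpose_mat B3 $$ (i, j) = B3 $$ (i, j)"
      using arg_cong[OF BT, of "\<lambda>M. M $$ (Suc i, Suc j)"] B by (simp add: B3_def)
  qed (simp_all add: B3_def)
  then obtain U D where U: "U \<in> carrier_mat m m" and D: "D \<in> carrier_mat m m" "diagonal_mat D"
    and UU: "U * transpose_mat U = 1\<^sub>m m" and B3_eq: "B3 = U * D * transpose_mat U"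
    using Suc.IH[OF B3] by blast
  define V where "V = four_block_mat (1\<^sub>m 1) (0\<^sub>m 1 m) (0\<^sub>m m 1) U"
  define F where "F = four_block_mat E (0\<^sub>m 1 m) (0\<^sub>m m 1) D"
  have V: "V \<in> carrier_mat ?n ?n" unfolding V_def using four_block_carrier_mat[OF one_carrier_mat[of 1] U] by simp
  have F: "F \<in> carrier_mat ?n ?n" unfolding F_def using four_block_carrier_mat[OF E D(1)] by simp
  have VT: "transpose_mat V = four_block_mat (1\<^sub>m 1) (0\<^sub>m 1 m) (0\<^sub>m m 1) (transpose_mat U)"
    unfolding V_def using U by (subst transpose_four_block_mat[of _ 1 1 _ m _ m]) auto
  have VV: "V * transpose_mat V = 1\<^sub>m ?n"
    unfolding VT unfolding V_def using U UU
    by (subst mult_four_block_mat[of _ 1 1 _ m _ m _ _ 1 _ m]) auto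
  have VFV: "V * F * transpose_mat V = B"
    unfolding VT B_block B3_eq unfolding V_def F_def using U D E
    by (simp add: mult_four_block_mat[of _ 1 1 _ m _ m _ _ 1 _ m])
  have "diagonal_mat F"
    using D E by (auto simp: diagonal_mat_def F_def)
  moreover have "(W * V) * transpose_mat (W * V) = 1\<^sub>m ?n"
  proof -
    have "(W * V) * transpose_mat (W * V) = W * (V * transpose_mat V) * W"
      using W V WT by (simp add: transpose_mult[of _ ?n ?n _ ?n] assoc_mult_mat[of _ ?n ?n _ ?n _ ?n])
    then show ?thesis using W WW VV by simp
  qed
  moreover have "A = (W * V) * F * transpose_mat (W * V)"
  proof -
    have "A = W * W * A * (W * W)" using WW A by simp
    also have "\<dots> = W * B * W" using W A by (simp add: B_def assoc_mult_mat[of _ ?n ?n _ ?n _ ?n])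
    also have "\<dots> = (W * V) * F * transpose_mat (W * V)"
      unfolding VFV[symmetric]
      using W V F WT by (simp add: transpose_mult[of _ ?n ?n _ ?n] assoc_mult_mat[of _ ?n ?n _ ?n _ ?n])
    finally show ?thesis .
  qed
  moreover have "W * V \<in> carrier_mat ?n ?n" using W V by simp
  ultimately show ?case using F by blast
qed

section \<open>The sum of the two largest eigenvalues\<close>

definition ip :: "'a set \<Rightarrow> ('a \<Rightarrow> real) \<Rightarrow> ('a \<Rightarrow> real) \<Rightarrow> real" where
  "ip I f g = (\<Sum>i\<in>I. f i * g i)"

text \<open>Uncurried, so that matrices are functions on a product of index sets and
  \<open>ip\<close> over the product is the Frobenius inner product.\<close>

definition outer :: "('a \<Rightarrow> real) \<Rightarrow> ('b \<Rightarrow> real) \<Rightarrow> 'a \<times> 'b \<Rightarrow> real" where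
  "outer u v = (\<lambda>(i, j). u i * v j)"

lemma ip_commute: "ip I f g = ip I g f"
  by (simp add: ip_def mult.commute)

lemma ip_add_left: "ip I (\<lambda>i. f i + g i) h = ip I f h + ip I g h"
  by (simp add: ip_def algebra_simps sum.distrib)

lemma ip_scale_left: "ip I (\<lambda>i. c * f i) h = c * ip I f h"
  by (simp add: ip_def sum_distrib_left mult.assoc)

lemma ip_add_right: "ip I h (\<lambda>i. f i + g i) = ip I h f + ip I h g"
  by (simp add: ip_commute[of I h] ip_add_left)

lemma ip_scale_right: "ip I h (\<lambda>i. c * f i) = c * ip I h f"
  by (simp add: ip_commute[of I h] ip_scale_left)

lemmas ip_linear = ip_add_left ip_add_right ip_scale_left ip_scale_right

lemma ip_cong: "(\<And>i. i \<in> I \<Longrightarrow> f i = f' i) \<Longrightarrow> (\<And>i. i \<in> I \<Longrightarrow> g i = g' i) \<Longrightarrow> ip I f g = ip I f' g'"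
  by (simp add: ip_def)

lemma ip_self_nonneg: "0 \<le> ip I f f"
  by (auto simp: ip_def intro: sum_nonneg)

lemma ip_self_eq_0: "finite I \<Longrightarrow> ip I f f = 0 \<Longrightarrow> i \<in> I \<Longrightarrow> f i = 0"
  by (simp add: ip_def sum_nonneg_eq_0_iff)

text \<open>The expanded square of the norm of \<open>f - g\<close>. Any test vector
  \<open>g\<close> bounds the norm of \<open>f\<close> from below, without normalization.\<close>

lemma ip_self_ge: "2 * ip I f g - ip I g g \<le> ip I f f"
proof -
  have "0 \<le> ip I (\<lambda>i. f i + (-1) * g i) (\<lambda>i. f i + (-1) * g i)" by (rule ip_self_nonneg)
  then show ?thesis
    unfolding ip_linear by (simp add: ip_commute[of I g f])
qed

lemma ip_outer:
  "ip (I \<times> J) (outer u v) (outer u' v') = ip I u u' * ip J v v'"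
proof -
  have "ip (I \<times> J) (outer u v) (outer u' v') = (\<Sum>i\<in>I. \<Sum>j\<in>J. (u i * u' i) * (v j * v' j))"
    by (simp add: ip_def outer_def sum.cartesian_product split_def algebra_simps)
  then show ?thesis by (simp add: ip_def sum_product)
qed

text \<open>With \<open>a\<close> and \<open>b\<close> the inner products of a vector with an
  orthonormal pair, this yields a unit vector in the plane of the pair orthogonal to that
  vector.\<close>

lemma exists_rotation_orthogonal:
  fixes a b :: real
  shows "\<exists>c s. c\<^sup>2 + s\<^sup>2 = 1 \<and> c * a + s * b = 0"
proof (cases "a = 0 \<and> b = 0")
  case True
  then show ?thesis by (intro exI[of _ 1] exI[of _ 0]) simp
next
  case False
  define r where "r = sqrt (a\<^sup>2 + b\<^sup>2)"
  have r: "r\<^sup>2 = a\<^sup>2 + b\<^sup>2" "r \<noteq> 0"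
    using False by (auto simp: r_def)
  have "(b / r)\<^sup>2 + (- a / r)\<^sup>2 = (a\<^sup>2 + b\<^sup>2) / r\<^sup>2"
    by (simp add: power_divide add_divide_distrib add.commute)
  also have "\<dots> = 1" unfolding r(1)[symmetric] using r(2) by simp
  finally have "(b / r)\<^sup>2 + (- a / r)\<^sup>2 = 1" .
  moreover have "b / r * a + - a / r * b = 0" by simp
  ultimately show ?thesis by blast
qed

section \<open>Orthonormalization of two possibly dependent vectors\<close>

lemma exists_normalized:
  assumes "finite I"
  shows "\<exists>f. ip I f f \<in> {0, 1} \<and> (\<exists>a. \<forall>i\<in>I. p i = a * f i)
    \<and> (\<forall>g. ip I p g = 0 \<longrightarrow> ip I f g = 0)"
proof (cases "ip I p p = 0")
  case True
  then have "\<forall>i\<in>I. p i = 0" using ip_self_eq_0[OF assms] by blast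
  then show ?thesis by (intro exI[of _ "\<lambda>_. 0"]) (auto simp: ip_def)
next
  case False
  define r where "r = sqrt (ip I p p)"
  have r: "r\<^sup>2 = ip I p p" "r \<noteq> 0" using False ip_self_nonneg[of I p] by (auto simp: r_def)
  have "ip I (\<lambda>i. inverse r * p i) (\<lambda>i. inverse r * p i) = 1"
    unfolding ip_linear r(1)[symmetric] using r(2) by (simp add: field_simps power2_eq_square)
  moreover have "\<forall>i\<in>I. p i = r * (inverse r * p i)" using r by simp
  moreover have "\<forall>g. ip I p g = 0 \<longrightarrow> ip I (\<lambda>i. inverse r * p i) g = 0"
    by (simp add: ip_linear)
  ultimately show ?thesis by blast
qed

text \<open>The value 0 for a squared norm allows zero vectors, so dependent \<open>p\<close> and
  \<open>q\<close> need no separate treatment. The last two equations are Parseval identities, as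
  \<open>p\<close> and \<open>q\<close> lie in the span of \<open>f\<close> and
  \<open>g\<close>.\<close>

lemma gram_schmidt_pair:
  assumes "finite I"
  obtains f g where "ip I f g = 0" "ip I f f \<in> {0, 1}" "ip I g g \<in> {0, 1}"
    "(ip I p f)\<^sup>2 + (ip I p g)\<^sup>2 = ip I p p" "(ip I q f)\<^sup>2 + (ip I q g)\<^sup>2 = ip I q q"
proof -
  obtain f a where f: "ip I f f \<in> {0, 1}" and p: "\<forall>i\<in>I. p i = a * f i"
    using exists_normalized[OF assms, of p] by blast
  define q' where "q' = (\<lambda>i. q i + (- ip I q f) * f i)"
  obtain g b where g: "ip I g g \<in> {0, 1}" and q': "\<forall>i\<in>I. q' i = b * g i"
    and g0: "\<And>h. ip I q' h = 0 \<Longrightarrow> ip I g h = 0"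
    using exists_normalized[OF assms, of q'] by blast
  have "ip I q' f = ip I q f * (1 - ip I f f)"
    unfolding q'_def ip_linear by (simp add: algebra_simps)
  moreover have "ip I q f = 0" if "ip I f f = 0"
    using ip_self_eq_0[OF assms that] by (simp add: ip_def)
  ultimately have "ip I q' f = 0" using f by auto
  then have fg: "ip I f g = 0" using g0 by (simp add: ip_commute[of I f g])
  have span: "(ip I h f)\<^sup>2 + (ip I h g)\<^sup>2 = ip I h h" if "\<forall>i\<in>I. h i = x * f i + y * g i" for h x y
  proof -
    have "ip I h k = ip I (\<lambda>i. x * f i + y * g i) k" for k
      using that by (intro ip_cong) auto
    moreover have "ip I h h = ip I (\<lambda>i. x * f i + y * g i) (\<lambda>i. x * f i + y * g i)"
      using that by (intro ip_cong) auto
    ultimately have "ip I h f = x * ip I f f" "ip I h g = y * ip I g g"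
        "ip I h h = x\<^sup>2 * ip I f f + y\<^sup>2 * ip I g g"
      using fg by (simp_all add: ip_linear ip_commute[of I g f] power2_eq_square algebra_simps)
    then show ?thesis using f g by (auto simp: power_mult_distrib)
  qed
  have "\<forall>i\<in>I. p i = a * f i + 0 * g i" using p by simp
  moreover have "\<forall>i\<in>I. q i = ip I q f * f i + b * g i" using q' by (auto simp: q'_def algebra_simps)
  ultimately show ?thesis using that[OF fg f g] span by blast
qed

text \<open>The projection \<open>k\<close> of \<open>h\<close> onto the span of \<open>f\<close>
  and \<open>g\<close> serves as test vector in \<open>ip_self_ge\<close>.\<close>

lemma bessel_pair:
  assumes "ip I f g = 0" "ip I f f \<in> {0, 1}" "ip I g g \<in> {0, 1}"
  shows "(ip I h f)\<^sup>2 + (ip I h g)\<^sup>2 \<le> ip I h h"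
proof -
  define k where "k = (\<lambda>i. ip I h f * f i + ip I h g * g i)"
  have "ip I h k = (ip I h f)\<^sup>2 + (ip I h g)\<^sup>2"
    by (simp add: k_def ip_linear power2_eq_square)
  moreover have "ip I k k = (ip I h f)\<^sup>2 * ip I f f + (ip I h g)\<^sup>2 * ip I g g"
    using assms(1) by (simp add: k_def ip_linear ip_commute[of I g f] power2_eq_square)
  moreover have "(ip I h f)\<^sup>2 * ip I f f \<le> (ip I h f)\<^sup>2 * 1" "(ip I h g)\<^sup>2 * ip I g g \<le> (ip I h g)\<^sup>2 * 1"
    using assms(2,3) by (auto intro!: mult_left_mono)
  ultimately show ?thesis using ip_self_ge[of I h k] by linarith
qed

text \<open>
  The constant \<open>23 / 20\<close> lies between \<open>(2 + \<surd>14) / 5 < 1.1484\<close>, which the hypotheses allow, and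
  \<open>2 / \<surd>3 > 1.1547\<close>, the asymptotic spread of the extremal complete split graphs.
\<close>

lemma sum_le_of_weighted_squares:
  fixes lam mu m n :: real
  assumes "0 < n" "m \<le> n" "lam\<^sup>2 + 3 * mu\<^sup>2 + (m - (lam + mu))\<^sup>2 / 2 \<le> n\<^sup>2"
  shows "lam + mu \<le> 23 / 20 * n"
proof (rule ccontr)
  assume "\<not> ?thesis"
  then have s: "lam + mu > 23 / 20 * n" by simp
  have "(23 / 20 * n)\<^sup>2 \<le> (lam + mu)\<^sup>2"
    using s assms(1) by (intro power_mono) auto
  moreover have "(3 / 20 * n)\<^sup>2 \<le> (lam + mu - m)\<^sup>2"
    using s assms(1,2) by (intro power_mono) auto
  moreover have "0 \<le> (lam - 3 * mu)\<^sup>2" by simp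
  \<comment> \<open>For a fixed sum the minimum is at \<open>lam = 3 * mu\<close>. The contradiction
    is \<open>3/4 * 529/400 + 1/2 * 9/400 = 1605/1600 > 1\<close>.\<close>
  moreover have "lam\<^sup>2 + 3 * mu\<^sup>2 = 3 / 4 * (lam + mu)\<^sup>2 + 1 / 4 * (lam - 3 * mu)\<^sup>2"
    by (simp add: power2_eq_square algebra_simps)
  moreover have "(m - (lam + mu))\<^sup>2 = (lam + mu - m)\<^sup>2" by (simp add: power2_commute)
  moreover have "(23 / 20 * n)\<^sup>2 = 529 / 400 * n\<^sup>2" "(3 / 20 * n)\<^sup>2 = 9 / 400 * n\<^sup>2"
    by (auto simp: power2_eq_square)
  moreover have "n\<^sup>2 > 0" using assms(1) by simp
  ultimately show False using assms(3) by linarith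
qed

section \<open>Compression of a matrix with entries in the unit interval to a plane\<close>

lemma ip_extend_zero:
  assumes "finite I" "J \<subseteq> I"
  shows "ip I h (\<lambda>i. if i \<in> J then f i else 0) = ip J h f"
    "ip I (\<lambda>i. if i \<in> J then f i else 0) h = ip J f h"
proof -
  have "ip J h f = ip J h (\<lambda>i. if i \<in> J then f i else 0)" by (intro ip_cong) auto
  also have "\<dots> = ip I h (\<lambda>i. if i \<in> J then f i else 0)"
    unfolding ip_def by (rule sum.mono_neutral_left) (use assms in auto)
  finally show *: "ip I h (\<lambda>i. if i \<in> J then f i else 0) = ip J h f" by simp
  then show "ip I (\<lambda>i. if i \<in> J then f i else 0) h = ip J f h"
    by (simp add: ip_commute[of _ _ h])
qed


text \<open>The left side is the trace of \<open>A\<close> compressed to the plane of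
  \<open>x\<close> and \<open>y\<close>. It is linear in \<open>A\<close>, so the entries can be
  optimized one by one.\<close>

lemma rank_two_trace_bound:
  fixes A :: "'a \<Rightarrow> 'a \<Rightarrow> real"
  assumes I: "finite I"
    and A: "\<And>i j. i \<in> I \<Longrightarrow> j \<in> I \<Longrightarrow> 0 \<le> A i j \<and> A i j \<le> 1"
    and x: "\<And>i. i \<in> I \<Longrightarrow> 0 \<le> x i"
    and xy: "ip I x x = 1" "ip I y y = 1" "ip I x y = 0"
  shows "ip (I \<times> I) (\<lambda>(i, j). A i j) (outer x x) + ip (I \<times> I) (\<lambda>(i, j). A i j) (outer y y)
    \<le> 23 / 20 * card I"
proof -
  \<comment> \<open>\<open>M\<close> is an entrywise optimal 0/1 matrix for \<open>P = x x\<^sup>T + y y\<^sup>T\<close>. Since \<open>x \<ge> 0\<close>, the entry \<open>P (i, j)\<close>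
    can be negative only when \<open>y i\<close> and \<open>y j\<close> have opposite signs, so \<open>N = J - M\<close> is bipartite.\<close>
  define n where "n = real (card I)"
  define same where "same i j \<longleftrightarrow> (0 \<le> y i \<longleftrightarrow> 0 \<le> y j)" for i j
  define P where "P = (\<lambda>(i, j). x i * x j + y i * y j)"
  define M where "M = (\<lambda>(i, j). if same i j \<or> 0 < P (i, j) then 1 else 0 :: real)"
  define N where "N = (\<lambda>p. 1 + (-1) * M p)"
  let ?ip = "ip (I \<times> I)"
  have P_outer: "P = (\<lambda>p. outer x x p + outer y y p)"
    by (auto simp: P_def outer_def)
  have le_M: "A i j * P (i, j) \<le> M (i, j) * P (i, j)" if ij: "i \<in> I" "j \<in> I" for i j
  proof (cases "0 < P (i, j)")
    case True
    then show ?thesis using A[OF ij] by (simp add: M_def)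
  next
    case False
    moreover have "0 \<le> P (i, j)" if "same i j"
    proof -
      have "0 \<le> y i * y j" using that by (auto simp: same_def zero_le_mult_iff)
      then show ?thesis using x[OF ij(1)] x[OF ij(2)] by (simp add: P_def)
    qed
    ultimately show ?thesis using A[OF ij] by (auto simp: M_def mult_nonneg_nonpos)
  qed
  have A_le: "?ip (\<lambda>(i, j). A i j) (outer x x) + ?ip (\<lambda>(i, j). A i j) (outer y y) \<le> ?ip M P"
    unfolding ip_add_right[symmetric] P_outer[symmetric] using le_M
    by (auto simp: ip_def intro!: sum_mono)

  \<comment> \<open>Rotate \<open>x, y\<close> to \<open>u, w\<close> with \<open>w\<close> orthogonal to the all-ones vector, so that \<open>w\<^sup>T M w = - w\<^sup>T N w\<close>.\<close>
  obtain c s where cs: "c\<^sup>2 + s\<^sup>2 = 1" "c * ip I x (\<lambda>_. 1) + s * ip I y (\<lambda>_. 1) = 0"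
    using exists_rotation_orthogonal by blast
  define w where "w = (\<lambda>i. c * x i + s * y i)"
  define u where "u = (\<lambda>i. (- s) * x i + c * y i)"
  have yx: "ip I y x = 0" using xy by (simp add: ip_commute)
  have w1: "ip I w (\<lambda>_. 1) = 0" using cs(2) by (simp add: w_def ip_linear)
  have ww: "ip I w w = 1" using cs(1) xy yx by (simp add: w_def ip_linear power2_eq_square)
  have uu: "ip I u u = 1" using cs(1) xy yx
    unfolding u_def ip_linear by (simp add: power2_eq_square add.commute)
  have uw: "ip I u w = 0" using xy yx unfolding u_def w_def ip_linear by (simp add: algebra_simps)
  \<comment> \<open>\<open>P\<close> is the projection onto the plane and thus the same for every
    orthonormal basis of it.\<close>
  have "outer x x p + outer y y p = (c\<^sup>2 + s\<^sup>2) * (outer x x p + outer y y p)" for p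
    using cs(1) by simp
  also have "\<dots> p = outer u u p + outer w w p" for p
    by (cases p) (simp add: outer_def u_def w_def power2_eq_square algebra_simps)
  finally have P_uw: "P = (\<lambda>p. outer u u p + outer w w p)"
    by (simp add: P_outer)

  define lam where "lam = ?ip M (outer u u)"
  define mu where "mu = ?ip M (outer w w)"
  have MP: "?ip M P = lam + mu" by (simp add: P_uw ip_add_right lam_def mu_def)

  define Vp where "Vp = {i \<in> I. 0 \<le> y i}"
  define Vm where "Vm = {i \<in> I. \<not> 0 \<le> y i}"
  have V: "Vp \<subseteq> I" "Vm \<subseteq> I" "Vp \<inter> Vm = {}" "I = Vp \<union> Vm" "finite Vp" "finite Vm"
    using I by (auto simp: Vp_def Vm_def)
  have split: "ip I f g = ip Vp f g + ip Vm f g" for f g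
    unfolding ip_def V(4) using V by (intro sum.union_disjoint) auto

  have N_norm: "2 * mu\<^sup>2 \<le> ?ip N N"
  proof -
    define wp where "wp = (\<lambda>i. if i \<in> Vp then w i else 0)"
    define wm where "wm = (\<lambda>i. if i \<in> Vm then w i else 0)"
    \<comment> \<open>\<open>H\<close> is the part of \<open>outer w w\<close> between the sign
      classes. As \<open>N\<close> vanishes inside the classes, \<open>H\<close> and
      \<open>outer w w\<close> have the same inner product with \<open>N\<close>.\<close>
    define H where "H = (\<lambda>p. outer wp wm p + outer wm wp p)"
    have ext: "ip I h wp = ip Vp h w" "ip I h wm = ip Vm h w"
      "ip I wp h = ip Vp w h" "ip I wm h = ip Vm w h" for h
      unfolding wp_def wm_def by (rule ip_extend_zero[OF I V(1)] ip_extend_zero[OF I V(2)])+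
    have res: "ip Vp w wp = ip Vp w w" "ip Vp w wm = 0" "ip Vm w wp = 0" "ip Vm w wm = ip Vm w w"
      using V(3) by (auto simp: ip_def wp_def wm_def intro!: sum.cong sum.neutral)
    have HH: "?ip H H = 2 * (ip Vp w w * ip Vm w w)"
      by (simp add: H_def ip_linear ip_outer ext(3,4) res)
    have Vm_eq: "ip Vm w w = 1 - ip Vp w w" using split[of w w] ww by simp
    have "4 * (ip Vp w w * ip Vm w w) = 1 - (1 - 2 * ip Vp w w)\<^sup>2"
      unfolding Vm_eq by (simp add: power2_eq_square algebra_simps)
    then have HH_le: "?ip H H \<le> 1 / 2"
      unfolding HH using zero_le_power2[of "1 - 2 * ip Vp w w"] by linarith
    have "?ip N H = ?ip N (outer w w)"
      unfolding ip_def
      by (intro sum.cong)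
        (auto simp: N_def M_def H_def outer_def wp_def wm_def same_def Vp_def Vm_def
          split: if_splits)
    also have "\<dots> = ?ip (\<lambda>_. 1) (outer w w) - mu"
      unfolding N_def ip_linear by (simp add: mu_def)
    also have "?ip (\<lambda>_. 1) (outer w w) = 0"
      using ip_outer[of I I "\<lambda>_. 1" "\<lambda>_. 1" w w] w1 by (simp add: outer_def split_def ip_commute)
    finally have "?ip N H = - mu" by simp
    \<comment> \<open>The factor \<open>- 2 * mu\<close> is the optimal multiple of \<open>H\<close>
      when its squared norm attains the bound \<open>1 / 2\<close>.\<close>
    then have "4 * mu\<^sup>2 - 4 * mu\<^sup>2 * ?ip H H \<le> ?ip N N"
      using ip_self_ge[of "I \<times> I" N "\<lambda>p. (- 2 * mu) * H p"]
      unfolding ip_linear by (simp add: power2_eq_square)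
    moreover have "4 * mu\<^sup>2 * ?ip H H \<le> 4 * mu\<^sup>2 * (1 / 2)"
      using HH_le by (intro mult_left_mono) auto
    ultimately show ?thesis by linarith
  qed

  \<comment> \<open>\<open>T\<close> is the projection onto the span of the restrictions of \<open>u\<close> and \<open>w\<close> to the two sign classes;
    it has no entries between the classes, and \<open>M\<close> is all ones inside them.\<close>
  obtain f1 f2 where f: "ip Vp f1 f2 = 0" "ip Vp f1 f1 \<in> {0, 1}" "ip Vp f2 f2 \<in> {0, 1}"
    "(ip Vp u f1)\<^sup>2 + (ip Vp u f2)\<^sup>2 = ip Vp u u" "(ip Vp w f1)\<^sup>2 + (ip Vp w f2)\<^sup>2 = ip Vp w w"
    using gram_schmidt_pair[OF V(5)] by metis
  obtain g1 g2 where g: "ip Vm g1 g2 = 0" "ip Vm g1 g1 \<in> {0, 1}" "ip Vm g2 g2 \<in> {0, 1}"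
    "(ip Vm u g1)\<^sup>2 + (ip Vm u g2)\<^sup>2 = ip Vm u u" "(ip Vm w g1)\<^sup>2 + (ip Vm w g2)\<^sup>2 = ip Vm w w"
    using gram_schmidt_pair[OF V(6)] by metis
  define F1 where "F1 = (\<lambda>i. if i \<in> Vp then f1 i else 0)"
  define F2 where "F2 = (\<lambda>i. if i \<in> Vp then f2 i else 0)"
  define G1 where "G1 = (\<lambda>i. if i \<in> Vm then g1 i else 0)"
  define G2 where "G2 = (\<lambda>i. if i \<in> Vm then g2 i else 0)"
  note FG_def = F1_def F2_def G1_def G2_def
  define T where "T = (\<lambda>p. outer F1 F1 p + outer F2 F2 p + outer G1 G1 p + outer G2 G2 p)"
  have ext: "ip I h F1 = ip Vp h f1" "ip I h F2 = ip Vp h f2" "ip I h G1 = ip Vm h g1" "ip I h G2 = ip Vm h g2"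
    "ip I F1 h = ip Vp f1 h" "ip I F2 h = ip Vp f2 h" "ip I G1 h = ip Vm g1 h" "ip I G2 h = ip Vm g2 h" for h
    unfolding FG_def by (rule ip_extend_zero[OF I V(1)] ip_extend_zero[OF I V(2)])+
  have res: "ip Vp h F1 = ip Vp h f1" "ip Vp h F2 = ip Vp h f2" "ip Vp h G1 = 0" "ip Vp h G2 = 0"
    "ip Vm h F1 = 0" "ip Vm h F2 = 0" "ip Vm h G1 = ip Vm h g1" "ip Vm h G2 = ip Vm h g2" for h
    using V(3) by (auto simp: ip_def FG_def intro!: sum.cong sum.neutral)
  \<comment> \<open>By the Parseval identities each value is the sum of the squared norms of the two
    restrictions.\<close>
  have Tu: "?ip (outer u u) T = 1" and Tw: "?ip (outer w w) T = 1"
    using f(4,5) g(4,5) uu ww split[of u u] split[of w w]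
    by (simp_all add: T_def ip_add_right ip_outer ext power2_eq_square)
  \<comment> \<open>The squared Frobenius norm of a projection is its rank, here at most
    four.\<close>
  have TT: "?ip T T \<le> 4"
  proof -
    have "?ip T T = (ip Vp f1 f1)\<^sup>2 + (ip Vp f2 f2)\<^sup>2 + (ip Vm g1 g1)\<^sup>2 + (ip Vm g2 g2)\<^sup>2"
      using f(1) g(1) by (simp add: T_def ip_linear ip_outer ext(5-8) res power2_eq_square
          ip_commute[of Vp f2 f1] ip_commute[of Vm g2 g1])
    then show ?thesis using f(2,3) g(2,3) by (auto simp: power2_eq_square)
  qed
  \<comment> \<open>Each of the four summands of \<open>T\<close> lives inside one class, where
    \<open>M\<close> is 1, and contributes the squared sum of its vector. Bessel for the all-ones
    vector bounds these by the class sizes.\<close>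
  have MT: "?ip M T \<le> n"
  proof -
    have block: "?ip M (outer h h) = (ip I (\<lambda>_. 1) h)\<^sup>2"
      if h: "\<And>i j. i \<in> I \<Longrightarrow> j \<in> I \<Longrightarrow> h i * h j \<noteq> 0 \<Longrightarrow> same i j" for h
    proof -
      have "M (i, j) * (h i * h j) = h i * h j" if "i \<in> I" "j \<in> I" for i j
        using h[OF that] by (cases "h i * h j = 0") (simp_all add: M_def)
      then have "?ip M (outer h h) = ?ip (outer (\<lambda>_. 1) (\<lambda>_. 1)) (outer h h)"
        unfolding ip_def by (intro sum.cong) (fastforce simp: outer_def)+
      then show ?thesis by (simp add: ip_outer power2_eq_square)
    qed
    have "?ip M T = ((ip I (\<lambda>_. 1) F1)\<^sup>2 + (ip I (\<lambda>_. 1) F2)\<^sup>2) + ((ip I (\<lambda>_. 1) G1)\<^sup>2 + (ip I (\<lambda>_. 1) G2)\<^sup>2)"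
      unfolding T_def ip_add_right
      by (subst (1 2 3 4) block) (auto simp: FG_def same_def Vp_def Vm_def split: if_splits)
    also have "\<dots> = ((ip Vp (\<lambda>_. 1) f1)\<^sup>2 + (ip Vp (\<lambda>_. 1) f2)\<^sup>2) + ((ip Vm (\<lambda>_. 1) g1)\<^sup>2 + (ip Vm (\<lambda>_. 1) g2)\<^sup>2)"
      by (simp add: ext)
    also have "\<dots> \<le> ip Vp (\<lambda>_. 1) (\<lambda>_. 1) + ip Vm (\<lambda>_. 1) (\<lambda>_. 1)"
      using bessel_pair[OF f(1-3)] bessel_pair[OF g(1-3)] by (rule add_mono)
    also have "\<dots> = n" unfolding split[symmetric] by (simp add: ip_def n_def)
    finally show ?thesis .
  qed

  have MN: "?ip M M + ?ip N N = n\<^sup>2"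
  proof -
    have "?ip M M + ?ip N N = (\<Sum>p\<in>I \<times> I. 1)"
      unfolding ip_def sum.distrib[symmetric]
      by (intro sum.cong) (auto simp: M_def N_def)
    then show ?thesis by (simp add: n_def power2_eq_square card_cartesian_product)
  qed
  \<comment> \<open>\<open>\<parallel>M - X\<parallel>\<^sup>2 \<ge> 0\<close> yields the share of the two smallest eigenvalues of \<open>M\<close> in its Frobenius norm
    without computing them.\<close>
  define t where "t = (?ip M T - (lam + mu)) / 2"
  \<comment> \<open>\<open>X\<close> is \<open>lam\<close> on \<open>u\<close>, \<open>mu\<close> on
    \<open>w\<close> and \<open>t\<close> on the rest of the range of \<open>T\<close>;
    \<open>t\<close> spreads the remaining trace evenly over two dimensions.\<close>
  define X where "X = (\<lambda>p. (lam - t) * outer u u p + (mu - t) * outer w w p + t * T p)"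
  have "?ip M X = (lam - t) * lam + (mu - t) * mu + t * ?ip M T"
    by (simp add: X_def ip_linear lam_def mu_def)
  also have "\<dots> = lam\<^sup>2 + mu\<^sup>2 + 2 * t\<^sup>2"
    by (simp add: t_def power2_eq_square field_simps)
  finally have MX: "?ip M X = lam\<^sup>2 + mu\<^sup>2 + 2 * t\<^sup>2" .
  have "?ip X X = (lam - t)\<^sup>2 + (mu - t)\<^sup>2 + t\<^sup>2 * ?ip T T + 2 * (lam - t) * t + 2 * (mu - t) * t"
    using Tu Tw ip_commute[of "I \<times> I" T "outer u u"] ip_commute[of "I \<times> I" T "outer w w"]
      uu ww uw ip_commute[of I w u]
    unfolding X_def ip_linear by (simp add: ip_outer power2_eq_square algebra_simps)
  moreover have "t\<^sup>2 * ?ip T T \<le> t\<^sup>2 * 4" using TT by (intro mult_left_mono) auto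
  ultimately have "?ip X X \<le> lam\<^sup>2 + mu\<^sup>2 + 2 * t\<^sup>2"
    by (simp add: power2_eq_square algebra_simps)
  then have "lam\<^sup>2 + mu\<^sup>2 + 2 * t\<^sup>2 \<le> ?ip M M"
    using ip_self_ge[of "I \<times> I" M X] MX by linarith
  moreover have "2 * t\<^sup>2 = (?ip M T - (lam + mu))\<^sup>2 / 2"
    by (simp add: t_def power_divide)
  ultimately have "lam\<^sup>2 + 3 * mu\<^sup>2 + (?ip M T - (lam + mu))\<^sup>2 / 2 \<le> n\<^sup>2"
    using MN N_norm by linarith
  moreover have "0 < n"
    using xy(1) I by (auto simp: n_def card_gt_0_iff ip_def)
  ultimately have "lam + mu \<le> 23 / 20 * n" using sum_le_of_weighted_squares MT by blast
  then show ?thesis using A_le MP by (simp add: n_def)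
qed

lemma abs_pair_cases:
  fixes a b :: real
  shows "\<bar>a\<bar> + \<bar>b\<bar> = a + b \<or> \<bar>a\<bar> + \<bar>b\<bar> = a - b \<or> \<bar>a\<bar> + \<bar>b\<bar> = b - a \<or> \<bar>a\<bar> + \<bar>b\<bar> = - a - b"
  by linarith

section \<open>Quadratic forms in an orthonormal eigenbasis\<close>

lemma ip_sum_left: "ip I (\<lambda>i. \<Sum>k\<in>K. f k i) h = (\<Sum>k\<in>K. ip I (f k) h)"
  unfolding ip_def sum_distrib_right by (rule sum.swap)

text \<open>\<open>V k\<close> is the eigenvector for \<open>d k\<close>, and the eigenvalues come
  in no particular order.\<close>

locale orthonormal_eigenbasis =
  fixes n :: nat and a :: "nat \<Rightarrow> nat \<Rightarrow> real" and d :: "nat \<Rightarrow> real" and V :: "nat \<Rightarrow> nat \<Rightarrow> real"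
  assumes orthonormal: "k < n \<Longrightarrow> l < n \<Longrightarrow> ip {..<n} (V k) (V l) = (if k = l then 1 else 0)"
    and complete: "i < n \<Longrightarrow> j < n \<Longrightarrow> (\<Sum>k<n. V k i * V k j) = (if i = j then 1 else 0)"
    and expansion: "i < n \<Longrightarrow> j < n \<Longrightarrow> a i j = (\<Sum>k<n. d k * (V k i * V k j))"
begin

definition qform :: "(nat \<Rightarrow> real) \<Rightarrow> real" where
  "qform x = ip ({..<n} \<times> {..<n}) (\<lambda>(i, j). a i j) (outer x x)"

lemma qform_alt: "qform x = (\<Sum>i<n. \<Sum>j<n. a i j * (x i * x j))"
  by (simp add: qform_def ip_def outer_def sum.cartesian_product split_def)

text \<open>Stated for a general \<open>b\<close>: it serves \<open>a\<close> itself and, with all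
  weights 1, the identity matrix in \<open>parseval\<close>.\<close>

lemma weighted_squares:
  assumes "\<And>i j. i < n \<Longrightarrow> j < n \<Longrightarrow> b i j = (\<Sum>k<n. c k * (V k i * V k j))"
  shows "ip ({..<n} \<times> {..<n}) (\<lambda>(i, j). b i j) (outer x x) = (\<Sum>k<n. c k * (ip {..<n} (V k) x)\<^sup>2)"
proof -
  have "ip ({..<n} \<times> {..<n}) (\<lambda>(i, j). b i j) (outer x x)
    = ip ({..<n} \<times> {..<n}) (\<lambda>p. \<Sum>k<n. c k * outer (V k) (V k) p) (outer x x)"
    using assms by (intro ip_cong) (auto simp: outer_def)
  then show ?thesis by (simp add: ip_sum_left ip_scale_left ip_outer power2_eq_square)
qed

lemma qform_eq: "qform x = (\<Sum>k<n. d k * (ip {..<n} (V k) x)\<^sup>2)"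
  unfolding qform_def by (rule weighted_squares) (rule expansion)

lemma parseval: "ip {..<n} x x = (\<Sum>k<n. (ip {..<n} (V k) x)\<^sup>2)"
proof -
  have "ip {..<n} x x = (\<Sum>i<n. \<Sum>j<n. if j = i then x i * x j else 0)"
    by (simp add: ip_def)
  also have "\<dots> = ip ({..<n} \<times> {..<n}) (\<lambda>(i, j). if i = j then 1 else 0) (outer x x)"
    unfolding ip_def outer_def sum.cartesian_product by (intro sum.cong) auto
  also have "\<dots> = (\<Sum>k<n. 1 * (ip {..<n} (V k) x)\<^sup>2)"
    by (rule weighted_squares) (simp add: complete)
  finally show ?thesis by simp
qed

lemma qform_le:
  assumes "\<And>k. k < n \<Longrightarrow> d k \<le> D"
  shows "qform x \<le> D * ip {..<n} x x"
  unfolding qform_eq parseval[of x] sum_distrib_left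
  using assms by (intro sum_mono mult_right_mono) auto

lemma qform_ge:
  assumes "\<And>k. k < n \<Longrightarrow> D \<le> d k"
  shows "D * ip {..<n} x x \<le> qform x"
  unfolding qform_eq parseval[of x] sum_distrib_left
  using assms by (intro sum_mono mult_right_mono) auto

lemma qform_eigenvector: "k < n \<Longrightarrow> qform (V k) = d k"
  unfolding qform_eq using sum.delta[of "{..<n}" k d]
  by (simp add: orthonormal if_distrib[of "\<lambda>x. _ * x\<^sup>2"] cong: if_cong)

lemma qform_combination:
  assumes "k < n" "l < n" "k \<noteq> l"
  shows "qform (\<lambda>i. c * V k i + s * V l i) = c\<^sup>2 * d k + s\<^sup>2 * d l"
proof -
  have "d m * (ip {..<n} (V m) (\<lambda>i. c * V k i + s * V l i))\<^sup>2
      = (if m = k then c\<^sup>2 * d k else 0) + (if m = l then s\<^sup>2 * d l else 0)" if "m < n" for m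
    using assms that by (simp add: ip_linear orthonormal)
  then show ?thesis
    unfolding qform_eq using assms by (simp add: sum.distrib)
qed

end

section \<open>Perron-Frobenius estimates and pairs of eigenvalues\<close>

locale unit_interval_eigenbasis = orthonormal_eigenbasis +
  assumes entries: "i < n \<Longrightarrow> j < n \<Longrightarrow> 0 \<le> a i j \<and> a i j \<le> 1"
begin

lemma abs_qform_le: "\<bar>qform x\<bar> \<le> qform (\<lambda>i. \<bar>x i\<bar>)"
proof -
  have "\<bar>qform x\<bar> \<le> (\<Sum>i<n. \<Sum>j<n. \<bar>a i j * (x i * x j)\<bar>)"
    unfolding qform_alt by (rule order_trans[OF sum_abs]) (intro sum_mono sum_abs)
  also have "\<dots> = qform (\<lambda>i. \<bar>x i\<bar>)"
    unfolding qform_alt using entries by (intro sum.cong) (auto simp: abs_mult)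
  finally show ?thesis .
qed

lemma ip_abs: "ip I (\<lambda>i. \<bar>x i\<bar>) (\<lambda>i. \<bar>x i\<bar>) = ip I x x" for x :: "nat \<Rightarrow> real"
  by (simp add: ip_def)

text \<open>The entrywise absolute value of the eigenvector is a unit test vector whose form is at
  least \<open>- d l\<close>.\<close>

lemma neg_eigenvalue_le:
  assumes "l < n" "\<And>m. m < n \<Longrightarrow> d m \<le> D"
  shows "- d l \<le> D"
  using abs_qform_le[of "V l"] qform_le[OF assms(2), of "\<lambda>i. \<bar>V l i\<bar>"] assms(1)
  by (simp add: qform_eigenvector ip_abs orthonormal)

lemma top_two_le:
  assumes kl: "k < n" "l < n" "k \<noteq> l" and max: "\<And>m. m < n \<Longrightarrow> d m \<le> d k"
  shows "d k + d l \<le> 23 / 20 * n"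
proof -
  \<comment> \<open>\<open>V k\<close> need not be nonnegative up to sign if \<open>d k\<close> is a multiple eigenvalue, whence the detour through \<open>x\<close>.\<close>
  define x where "x = (\<lambda>i. \<bar>V k i\<bar>)"
  have xx: "ip {..<n} x x = 1" using kl by (simp add: x_def ip_abs orthonormal)
  have Qx: "d k \<le> qform x" using abs_qform_le[of "V k"] kl by (simp add: x_def qform_eigenvector)
  obtain c s where cs: "c\<^sup>2 + s\<^sup>2 = 1" "c * ip {..<n} x (V k) + s * ip {..<n} x (V l) = 0"
    using exists_rotation_orthogonal by blast
  define y where "y = (\<lambda>i. c * V k i + s * V l i)"
  have xy: "ip {..<n} x y = 0" using cs(2) unfolding y_def ip_linear .
  have yy: "ip {..<n} y y = 1"
    using cs(1) kl unfolding y_def ip_linear by (simp add: orthonormal power2_eq_square)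
  \<comment> \<open>On the plane of \<open>V k\<close> and \<open>V l\<close> the form of a unit
    vector is a convex combination of \<open>d k\<close> and \<open>d l\<close>, hence at least the
    smaller one, \<open>d l\<close>.\<close>
  have "d l = (c\<^sup>2 + s\<^sup>2) * d l" using cs by simp
  also have "\<dots> \<le> c\<^sup>2 * d k + s\<^sup>2 * d l"
    using max[OF kl(2)] by (simp add: algebra_simps mult_right_mono)
  also have "\<dots> = qform y" using qform_combination[OF kl] by (simp add: y_def)
  finally have Qy: "d l \<le> qform y" .
  have "qform x + qform y \<le> 23 / 20 * card {..<n}"
    unfolding qform_def by (rule rank_two_trace_bound) (use entries xx xy yy in \<open>auto simp: x_def\<close>)
  then show ?thesis using Qx Qy by simp
qed

text \<open>Case distinction on signs. For two negative values, one is at least \<open>E\<close> and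
  the other at least \<open>- D\<close>, which again gives \<open>D - E\<close>.\<close>

lemma abs_pair_le:
  assumes ij: "i < n" "j < n" "i \<noteq> j"
    and D: "D \<in> d ` {..<n}" "\<And>m. m < n \<Longrightarrow> d m \<le> D" and E: "\<And>m. m < n \<Longrightarrow> E \<le> d m"
  shows "\<bar>d i\<bar> + \<bar>d j\<bar> \<le> max (D - E) (23 / 20 * n)"
proof -
  obtain k where k: "k < n" "D = d k" using D(1) by auto
  \<comment> \<open>The index \<open>k\<close> of the maximum replaces \<open>i\<close> or
    \<open>j\<close>, while the other index stays distinct from it.\<close>
  obtain l where l: "l < n" "l \<noteq> k" "d i + d j \<le> d k + d l"
  proof (cases "i = k")
    case True
    then show ?thesis using that[of j] ij by simp
  next
    case False
    then show ?thesis using that[of i] ij D(2)[of j] k by simp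
  qed
  have "d i + d j \<le> 23 / 20 * n"
    using top_two_le[of k l] k l D(2) by fastforce
  moreover have "- d j \<le> D" using neg_eigenvalue_le[OF ij(2) D(2)] .
  ultimately show ?thesis
    using D(2)[OF ij(1)] D(2)[OF ij(2)] E[OF ij(1)] E[OF ij(2)] abs_pair_cases[of "d i" "d j"]
    by linarith
qed

end

section \<open>Spectra of graphs\<close>

text \<open>Translates sorted positions, as in \<open>eigval\<close>, into indices of the unsorted
  list; bijectivity keeps track of multiplicities.\<close>

lemma rev_sort_reindex:
  fixes xs :: "real list"
  obtains f where "bij_betw f {..<length xs} {..<length xs}"
    "\<And>k. k < length xs \<Longrightarrow> rev (sort xs) ! k = xs ! f k"
    "\<And>k l. k \<le> l \<Longrightarrow> l < length xs \<Longrightarrow> xs ! f l \<le> xs ! f k"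
proof -
  have "mset (rev (sort xs)) = mset xs" by simp
  then obtain f where f: "bij_betw f {..<length xs} {..<length xs}"
    "\<And>k. k < length xs \<Longrightarrow> rev (sort xs) ! k = xs ! f k"
    using permutation_Ex_bij[of "rev (sort xs)" xs] by auto
  have "xs ! f l \<le> xs ! f k" if "k \<le> l" "l < length xs" for k l
    using that sorted_rev_nth_mono[of "rev (sort xs)" k l] f(2)[of k] f(2)[of l] by simp
  then show ?thesis using that f by blast
qed

lemma index_mult_mat_sum:
  "X \<in> carrier_mat n n \<Longrightarrow> Y \<in> carrier_mat n n \<Longrightarrow> i < n \<Longrightarrow> j < n \<Longrightarrow>
    (X * Y) $$ (i, j) = (\<Sum>k<n. X $$ (i, k) * Y $$ (k, j))"
  by (simp add: scalar_prod_def atLeast0LessThan)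

lemma proots_char_poly_diagonalized:
  fixes A :: "real mat"
  assumes U: "U \<in> carrier_mat n n" "U * transpose_mat U = 1\<^sub>m n"
    and D: "D \<in> carrier_mat n n" "diagonal_mat D" and A: "A = U * D * transpose_mat U"
  shows "proots (char_poly A) = mset (map (\<lambda>k. D $$ (k, k)) [0..<n])"
proof -
  have "transpose_mat U * U = 1\<^sub>m n"
    using mat_mult_left_right_inverse[of U n "transpose_mat U"] U by simp
  then have "similar_mat A D"
    unfolding similar_mat_def similar_mat_wit_def Let_def using U D A
    by (intro exI[of _ U] exI[of _ "transpose_mat U"]) auto
  moreover have "upper_triangular D"
    using D by (auto simp: diagonal_mat_def)
  ultimately have "char_poly A = (\<Prod>x \<leftarrow> diag_mat D. [:- x, 1:])"
    using char_poly_similar char_poly_upper_triangular[OF D(1)] by metis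
  moreover have "proots (\<Prod>x \<leftarrow> xs. [:- x, 1:]) = mset xs" for xs :: "real list"
  proof -
    have "(\<Prod>x \<leftarrow> ys. [:- x, 1:]) \<noteq> 0" for ys :: "real list"
      by (induction ys) (auto simp del: mult_pCons_left)
    then show ?thesis by (induction xs) (simp_all add: proots_mult del: mult_pCons_left)
  qed
  ultimately have "proots (char_poly A) = mset (diag_mat D)" by simp
  then show ?thesis using D(1) by (simp add: diag_mat_def)
qed

text \<open>By symmetry \<open>transpose_mat A * A\<close> is
  \<open>U * (D * D) * transpose_mat U\<close>, so one family \<open>d\<close> describes both
  spectra and the singular values are the absolute values of the \<open>d k\<close>.\<close>

lemma symmetric_eigenbasis:
  fixes A :: "real mat"
  assumes A: "A \<in> carrier_mat n n" and sym: "transpose_mat A = A"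
  obtains d V where "orthonormal_eigenbasis n (\<lambda>i j. A $$ (i, j)) d V"
    "proots (char_poly A) = mset (map d [0..<n])"
    "proots (char_poly (transpose_mat A * A)) = mset (map (\<lambda>k. (d k)\<^sup>2) [0..<n])"
proof -
  obtain U D where U: "U \<in> carrier_mat n n" "U * transpose_mat U = 1\<^sub>m n"
    and D: "D \<in> carrier_mat n n" "diagonal_mat D" and A_eq: "A = U * D * transpose_mat U"
    using real_symmetric_diagonalization[OF assms] by blast
  have U': "transpose_mat U * U = 1\<^sub>m n"
    using mat_mult_left_right_inverse[of U n "transpose_mat U"] U by simp
  define d where "d k = D $$ (k, k)" for k
  define V where "V k i = U $$ (i, k)" for k i
  have D_eq: "D $$ (i, j) = (if i = j then d i else 0)" if "i < n" "j < n" for i j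
    using D that by (auto simp: diagonal_mat_def d_def)
  have basis: "orthonormal_eigenbasis n (\<lambda>i j. A $$ (i, j)) d V"
  proof
    fix k l assume "k < n" "l < n"
    then show "ip {..<n} (V k) (V l) = (if k = l then 1 else 0)"
      using arg_cong[OF U', of "\<lambda>M. M $$ (k, l)"] U
      by (simp add: ip_def V_def scalar_prod_def atLeast0LessThan)
  next
    fix i j assume ij: "i < n" "j < n"
    then show "(\<Sum>k<n. V k i * V k j) = (if i = j then 1 else 0)"
      using arg_cong[OF U(2), of "\<lambda>M. M $$ (i, j)"] U(1)
      by (simp add: V_def scalar_prod_def atLeast0LessThan)
    have UD: "(U * D) $$ (i, k) = U $$ (i, k) * d k" if "k < n" for k
    proof -
      have "(U * D) $$ (i, k) = (\<Sum>m<n. U $$ (i, m) * D $$ (m, k))"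
        using U(1) D(1) ij(1) that by (rule index_mult_mat_sum)
      also have "\<dots> = (\<Sum>m<n. if m = k then U $$ (i, k) * d k else 0)"
        using that by (intro sum.cong) (auto simp: D_eq)
      finally show ?thesis using that by simp
    qed
    have "A $$ (i, j) = (\<Sum>k<n. (U * D) $$ (i, k) * transpose_mat U $$ (k, j))"
      unfolding A_eq using U(1) D(1) ij by (intro index_mult_mat_sum) auto
    also have "\<dots> = (\<Sum>k<n. (U * D) $$ (i, k) * U $$ (j, k))"
      using U(1) ij by (intro sum.cong) auto
    finally have "A $$ (i, j) = (\<Sum>k<n. (U * D) $$ (i, k) * U $$ (j, k))" .
    then show "A $$ (i, j) = (\<Sum>k<n. d k * (V k i * V k j))"
      by (simp add: UD V_def mult_ac)
  qed
  have "(D * D) $$ (i, j) = (if i = j then (d i)\<^sup>2 else 0)" if "i < n" "j < n" for i j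
  proof -
    have "(D * D) $$ (i, j) = (\<Sum>k<n. D $$ (i, k) * D $$ (k, j))"
      using D(1) D(1) that by (rule index_mult_mat_sum)
    also have "\<dots> = (\<Sum>k<n. if k = i then d i * D $$ (i, j) else 0)"
      using that by (intro sum.cong) (auto simp: D_eq)
    finally show ?thesis using that by (auto simp: D_eq power2_eq_square)
  qed
  then have DD: "diagonal_mat (D * D)" "map (\<lambda>k. (D * D) $$ (k, k)) [0..<n] = map (\<lambda>k. (d k)\<^sup>2) [0..<n]"
    using D by (auto simp: diagonal_mat_def simp del: index_mult_mat(1))
  have "transpose_mat A * A = U * (D * (transpose_mat U * U) * D) * transpose_mat U"
    unfolding sym unfolding A_eq using U D
    by (simp add: assoc_mult_mat[of _ n n _ n _ n])
  then have "transpose_mat A * A = U * (D * D) * transpose_mat U"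
    using U' D by simp
  moreover have "D * D \<in> carrier_mat n n" using D by simp
  ultimately have "proots (char_poly (transpose_mat A * A)) = mset (map (\<lambda>k. (d k)\<^sup>2) [0..<n])"
    using proots_char_poly_diagonalized[OF U _ DD(1)] unfolding DD(2) by blast
  moreover have "proots (char_poly A) = mset (map d [0..<n])"
    using proots_char_poly_diagonalized[OF U D A_eq] unfolding d_def[abs_def] .
  ultimately show ?thesis using that basis by blast
qed

text \<open>In the proof \<open>f\<close> sorts the eigenvalues by value and \<open>g\<close> by
  absolute value. For \<open>2 \<le> n\<close> the extreme eigenvalues sit at distinct indices, so
  their absolute values sum to at most the two largest.\<close>

lemma graph_spectrum:
  assumes G: "G \<in> graphs_of_order n" and n: "2 \<le> n"
  obtains d V where "unit_interval_eigenbasis n (\<lambda>i j. if (i, j) \<in> parcs G then 1 else 0) d V"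
    "graph_eigval G 1 \<in> d ` {..<n}" "\<And>k. k < n \<Longrightarrow> d k \<le> graph_eigval G 1"
    "\<And>k. k < n \<Longrightarrow> graph_eigval G n \<le> d k"
    "graph_eigval G 1 - graph_eigval G n \<le> F2_norm G"
    "\<exists>i<n. \<exists>j<n. i \<noteq> j \<and> F2_norm G = \<bar>d i\<bar> + \<bar>d j\<bar>"
proof -
  interpret pair_graph G using G by (simp add: graphs_of_order_def)
  define A where "A = adjacency_matrix G"
  have A_eq: "A = mat n n (\<lambda>(i, j). if (i, j) \<in> parcs G then 1 else 0)"
    using G by (simp add: A_def adjacency_matrix_def graphs_of_order_def)
  then have A: "A \<in> carrier_mat n n" by simp
  have "(i, j) \<in> parcs G \<longleftrightarrow> (j, i) \<in> parcs G" for i j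
    using arcs_symmetric by blast
  then have "transpose_mat A = A" unfolding A_eq by (intro eq_matI) auto
  then obtain d V where basis: "orthonormal_eigenbasis n (\<lambda>i j. A $$ (i, j)) d V"
    and spec: "proots (char_poly A) = mset (map d [0..<n])"
    and spec2: "proots (char_poly (transpose_mat A * A)) = mset (map (\<lambda>k. (d k)\<^sup>2) [0..<n])"
    using symmetric_eigenbasis[OF A] by blast
  interpret B: orthonormal_eigenbasis n "\<lambda>i j. A $$ (i, j)" d V by (rule basis)
  have B': "unit_interval_eigenbasis n (\<lambda>i j. if (i, j) \<in> parcs G then 1 else 0) d V"
  proof
    fix i j assume "i < n" "j < n"
    then show "(if (i, j) \<in> parcs G then 1 else 0) = (\<Sum>k<n. d k * (V k i * V k j))"
      using B.expansion[of i j] by (simp add: A_eq)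
  qed (auto simp: B.orthonormal B.complete)
  obtain f where f: "bij_betw f {..<n} {..<n}" "\<And>k. k < n \<Longrightarrow> rev (sort (map d [0..<n])) ! k = d (f k)"
    "\<And>k l. k \<le> l \<Longrightarrow> l < n \<Longrightarrow> d (f l) \<le> d (f k)"
  proof (rule rev_sort_reindex[of "map d [0..<n]"])
    fix f assume *: "bij_betw f {..<length (map d [0..<n])} {..<length (map d [0..<n])}"
      "\<And>k. k < length (map d [0..<n]) \<Longrightarrow> rev (sort (map d [0..<n])) ! k = map d [0..<n] ! f k"
      "\<And>k l. k \<le> l \<Longrightarrow> l < length (map d [0..<n]) \<Longrightarrow> map d [0..<n] ! f l \<le> map d [0..<n] ! f k"
    have "f k < n" if "k < n" for k using bij_betwE[OF *(1)] that by simp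
    then show ?thesis using that[of f] * by simp
  qed
  obtain g where g: "bij_betw g {..<n} {..<n}" "\<And>k. k < n \<Longrightarrow> rev (sort (map (\<lambda>k. (d k)\<^sup>2) [0..<n])) ! k = (d (g k))\<^sup>2"
    "\<And>k l. k \<le> l \<Longrightarrow> l < n \<Longrightarrow> (d (g l))\<^sup>2 \<le> (d (g k))\<^sup>2"
  proof (rule rev_sort_reindex[of "map (\<lambda>k. (d k)\<^sup>2) [0..<n]"])
    let ?xs = "map (\<lambda>k. (d k)\<^sup>2) [0..<n]"
    fix g assume *: "bij_betw g {..<length ?xs} {..<length ?xs}"
      "\<And>k. k < length ?xs \<Longrightarrow> rev (sort ?xs) ! k = ?xs ! g k"
      "\<And>k l. k \<le> l \<Longrightarrow> l < length ?xs \<Longrightarrow> ?xs ! g l \<le> ?xs ! g k"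
    have "g k < n" if "k < n" for k using bij_betwE[OF *(1)] that by simp
    then show ?thesis using that[of g] * by simp
  qed
  have fg_less: "f k < n" "g k < n" if "k < n" for k
    using that bij_betwE[OF f(1)] bij_betwE[OF g(1)] by auto
  have onto: "\<exists>l<n. f l = k" "\<exists>l<n. g l = k" if "k < n" for k
    using that f(1) g(1) by (auto simp: bij_betw_def image_iff dest!: equalityD2)
  have neq: "f 0 \<noteq> f (n - 1)" "g 0 \<noteq> g 1"
    using inj_on_eq_iff[OF bij_betw_imp_inj_on[OF f(1)], of 0 "n - 1"]
      inj_on_eq_iff[OF bij_betw_imp_inj_on[OF g(1)], of 0 1] n by simp_all
  have top: "graph_eigval G 1 = d (f 0)" and bot: "graph_eigval G n = d (f (n - 1))"
    unfolding graph_eigval_def eigval_def A_def[symmetric] spec sorted_list_of_multiset_mset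
    using f(2)[of 0] f(2)[of "n - 1"] n by simp_all
  have F2: "F2_norm G = \<bar>d (g 0)\<bar> + \<bar>d (g 1)\<bar>"
    unfolding F2_norm_def singval_def eigval_def A_def[symmetric] spec2 sorted_list_of_multiset_mset
    using g(2)[of 0] g(2)[of 1] n by simp
  have abs_mono: "\<bar>d (g l)\<bar> \<le> \<bar>d (g k)\<bar>" if "k \<le> l" "l < n" for k l
    using g(3)[OF that] by (simp add: abs_le_square_iff)
  have pair: "\<bar>d (g k)\<bar> + \<bar>d (g l)\<bar> \<le> F2_norm G" if "k < n" "l < n" "k < l" for k l
    unfolding F2 using that abs_mono[of 0 k] abs_mono[of 1 l] by simp
  \<comment> \<open>Positions of the two extreme eigenvalues in the order by absolute value.\<close>
  obtain k l where kl: "k < n" "l < n" "g k = f 0" "g l = f (n - 1)"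
    using onto(2)[OF fg_less(1)[of 0]] onto(2)[OF fg_less(1)[of "n - 1"]] n by auto
  have "k \<noteq> l" using kl neq by auto
  then have "\<bar>d (f 0)\<bar> + \<bar>d (f (n - 1))\<bar> \<le> F2_norm G"
    using pair[of k l] pair[of l k] kl by (cases "k < l") auto
  then have spread: "graph_eigval G 1 - graph_eigval G n \<le> F2_norm G"
    unfolding top bot by linarith
  have le_top: "d k \<le> graph_eigval G 1" and bot_le: "graph_eigval G n \<le> d k" if "k < n" for k
    using onto(1)[OF that] f(3) unfolding top bot by fastforce+
  show ?thesis
  proof (rule that[OF B'])
    show "graph_eigval G 1 \<in> d ` {..<n}" using top fg_less(1)[of 0] n by auto
    show "\<exists>i<n. \<exists>j<n. i \<noteq> j \<and> F2_norm G = \<bar>d i\<bar> + \<bar>d j\<bar>"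
      using F2 neq fg_less(2)[of 0] fg_less(2)[of 1] n by auto
  qed (use le_top bot_le spread in auto)
qed

section \<open>A lower bound for the spread from complete split graphs\<close>

definition complete_split_graph :: "nat \<Rightarrow> nat \<Rightarrow> nat pair_pre_digraph" where
  "complete_split_graph k n = \<lparr>pverts = {0..<n},
     parcs = {(i, j). i < n \<and> j < n \<and> i \<noteq> j \<and> (i < k \<or> j < k)}\<rparr>"

lemma complete_split_graph_order: "complete_split_graph k n \<in> graphs_of_order n"
proof -
  have "finite {(i, j). i < n \<and> j < n \<and> i \<noteq> j \<and> (i < k \<or> j < k)}"
    by (rule finite_subset[of _ "{..<n} \<times> {..<n}"]) auto
  then have "pair_graph (complete_split_graph k n)"
    by unfold_locales (auto simp: complete_split_graph_def symmetric_def sym_def)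
  then show ?thesis by (simp add: graphs_of_order_def complete_split_graph_def)
qed

text \<open>Rayleigh quotients of vectors constant on the clique and on \<open>m\<close> independent
  vertices, and zero elsewhere. The constant 3.46 is just below \<open>2 * sqrt 3\<close>.\<close>

lemma complete_split_graph_spread:
  assumes n: "3 * m \<le> n" and m: "0 < m"
  defines "G \<equiv> complete_split_graph (2 * m) n"
  shows "3.46 * real m - 1 \<le> graph_eigval G 1 - graph_eigval G n"
proof -
  have "2 \<le> n" using n m by simp
  then obtain d V where B: "unit_interval_eigenbasis n (\<lambda>i j. if (i, j) \<in> parcs G then 1 else 0) d V"
    and top: "\<And>k. k < n \<Longrightarrow> d k \<le> graph_eigval G 1" and bot: "\<And>k. k < n \<Longrightarrow> graph_eigval G n \<le> d k"
    unfolding G_def by (rule graph_spectrum[OF complete_split_graph_order]) blast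
  interpret unit_interval_eigenbasis n "\<lambda>i j. if (i, j) \<in> parcs G then 1 else 0" d V by (rule B)
  \<comment> \<open>\<open>t = 7/10\<close> and \<open>t = - 27/10\<close> approximate the eigenvectors of the two extreme eigenvalues, which
    have \<open>t \<approx> - 1 \<plusminus> \<surd>3\<close>.\<close>
  define c where "c i = (if i < 2 * m then 1 else 0 :: real)" for i
  define e where "e t i = (if 2 * m \<le> i \<and> i < 3 * m then t else 0 :: real)" for t i
  define x where "x t i = c i + e t i" for t i
  have sum_c: "(\<Sum>i<n. c i) = 2 * m"
  proof -
    have "{i \<in> {..<n}. i < 2 * m} = {..<2 * m}" using n by auto
    then show ?thesis by (simp add: c_def sum.inter_filter[symmetric])
  qed
  have sum_e: "(\<Sum>i<n. e t i) = m * t" for t :: real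
  proof -
    have "{i \<in> {..<n}. 2 * m \<le> i \<and> i < 3 * m} = {2 * m..<3 * m}" using n by auto
    then show ?thesis by (simp add: e_def sum.inter_filter[symmetric])
  qed
  have norm_x: "ip {..<n} (x t) (x t) = m * (2 + t\<^sup>2)" for t :: real
  proof -
    have "ip {..<n} (x t) (x t) = (\<Sum>i<n. c i + e (t\<^sup>2) i)"
      unfolding ip_def by (intro sum.cong) (auto simp: x_def c_def e_def power2_eq_square)
    then show ?thesis by (simp add: sum.distrib sum_c sum_e algebra_simps)
  qed
  have qform_x: "qform (x t) = m * (4 * m + 4 * m * t - 2)" for t :: real
  proof -
    \<comment> \<open>On the support of \<open>x t\<close> the adjacency matrix is all ones minus
      the independent block minus the identity on the clique.\<close>
    have "qform (x t) = (\<Sum>i<n. \<Sum>j<n. x t i * x t j - e t i * e t j - (if j = i then c i else 0))"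
      unfolding qform_alt
    proof (intro sum.cong refl)
      fix i j assume "i \<in> {..<n}" "j \<in> {..<n}"
      then show "(if (i, j) \<in> parcs G then 1 else 0) * (x t i * x t j)
          = x t i * x t j - e t i * e t j - (if j = i then c i else 0)"
        by (cases "i < 2 * m"; cases "j < 2 * m"; cases "i = j")
          (simp_all add: G_def complete_split_graph_def x_def c_def e_def)
    qed
    also have "\<dots> = (\<Sum>i<n. x t i) * (\<Sum>i<n. x t i) - (\<Sum>i<n. e t i) * (\<Sum>i<n. e t i) - (\<Sum>i<n. c i)"
      by (simp add: sum_subtractf sum_product)
    also have "\<dots> = m * (4 * m + 4 * m * t - 2)"
      by (simp add: x_def sum.distrib sum_c sum_e algebra_simps)
    finally show ?thesis .
  qed
  have "m * (4 * m + 4 * m * t - 2) \<le> m * (graph_eigval G 1 * (2 + t\<^sup>2))" for t :: real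
    using qform_le[OF top, of "x t"] unfolding qform_x norm_x by (simp add: mult_ac)
  then have "4 * m + 4 * m * t - 2 \<le> graph_eigval G 1 * (2 + t\<^sup>2)" for t :: real
    using m by simp
  from this[of "7 / 10"] have upper: "6.8 * m - 2 \<le> graph_eigval G 1 * 2.49"
    by (simp add: power2_eq_square)
  have "m * (graph_eigval G n * (2 + t\<^sup>2)) \<le> m * (4 * m + 4 * m * t - 2)" for t :: real
    using qform_ge[OF bot, of "x t"] unfolding qform_x norm_x by (simp add: mult_ac)
  then have "graph_eigval G n * (2 + t\<^sup>2) \<le> 4 * m + 4 * m * t - 2" for t :: real
    using m by simp
  from this[of "- 27 / 10"] have lower: "graph_eigval G n * 9.29 \<le> - 6.8 * m - 2"
    by (simp add: power2_eq_square)
  from upper lower show ?thesis by simp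
qed

theorem mainTheorem6:
  shows "\<forall>\<^sub>F n in sequentially.
    Max ((\<lambda>G. graph_eigval G 1 - graph_eigval G n) ` graphs_of_order n) =
    Max (F2_norm ` graphs_of_order n)"
  unfolding eventually_sequentially
\<comment> \<open>With \<open>m = n div 3 \<ge> (n - 2) / 3\<close>, the bound
  \<open>3.46 * m - 1\<close> reaches \<open>23 / 20 * n\<close> once
  \<open>n \<ge> 992\<close>.\<close>
proof (intro exI[of _ 1000] allI impI)
  fix n :: nat assume n: "1000 \<le> n"
  let ?spread = "\<lambda>G. graph_eigval G 1 - graph_eigval G n"
  let ?S = "Max (?spread ` graphs_of_order n)" and ?F = "Max (F2_norm ` graphs_of_order n)"
  have n2: "2 \<le> n" using n by simp
  have spread_le: "?spread G \<le> ?S" if "G \<in> graphs_of_order n" for G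
    using that by (simp add: finite_graphs_of_order)
  have F_le: "F2_norm G \<le> ?F" if "G \<in> graphs_of_order n" for G
    using that by (simp add: finite_graphs_of_order)
  have large: "23 / 20 * n \<le> ?S"
  proof -
    have "real n \<le> 3 * real (n div 3) + 2" "3 * (n div 3) \<le> n" "0 < n div 3" using n by linarith+
    then show ?thesis
      using complete_split_graph_spread[of "n div 3" n] n
        spread_le[OF complete_split_graph_order[of "2 * (n div 3)" n]] by simp
  qed
  show "?S = ?F"
  proof (rule antisym)
    have "?spread G \<le> ?F" if "G \<in> graphs_of_order n" for G
      by (rule graph_spectrum[OF that n2]) (use F_le[OF that] in linarith)
    then show "?S \<le> ?F"
      by (simp add: finite_graphs_of_order graphs_of_order_nonempty)
    have "F2_norm G \<le> ?S" if G: "G \<in> graphs_of_order n" for G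
    proof -
      obtain d V where B: "unit_interval_eigenbasis n (\<lambda>i j. if (i, j) \<in> parcs G then 1 else 0) d V"
        and spec: "graph_eigval G 1 \<in> d ` {..<n}" "\<And>k. k < n \<Longrightarrow> d k \<le> graph_eigval G 1"
          "\<And>k. k < n \<Longrightarrow> graph_eigval G n \<le> d k"
        and F: "\<exists>i<n. \<exists>j<n. i \<noteq> j \<and> F2_norm G = \<bar>d i\<bar> + \<bar>d j\<bar>"
        by (rule graph_spectrum[OF G n2]) blast
      from F obtain i j where ij: "i < n" "j < n" "i \<noteq> j" "F2_norm G = \<bar>d i\<bar> + \<bar>d j\<bar>" by blast
      have "F2_norm G \<le> max (?spread G) (23 / 20 * n)"
        unfolding ij(4) by (rule unit_interval_eigenbasis.abs_pair_le[OF B ij(1-3) spec])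
      then show ?thesis using spread_le[OF G] large by simp
    qed
    then show "?F \<le> ?S"
      by (simp add: finite_graphs_of_order graphs_of_order_nonempty)
  qed
qed

end
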